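(* Let $B,B'\in M_n(R)$ and suppose $B'=A^\nabla BA$ for some non-singular matrix $A\in M_n(R)$ (i.e. $B$ is tropically similar to $B'$). Then $f_{B'}\models_{gs}f_B$, where $f_M(x)=\det(xI+M)$ is the characteristic polynomial.
   Context: Supertropical semiring $R=T\cup G\cup\{-\infty\}$: $T=\mathcal G$ an ordered abelian group (tangible), $G=\{a^\nu\}$ a copy (ghost); $a+b$ is the element of larger $\nu$-value if the $\nu$-values differ and $a^\nu$ if equal; multiplication adds $\nu$-values, is ghost if a factor is ghost, $-\infty$ absorbing; $0_R=-\infty$, $1_R=0$. Ghost surpassing: $a\models_{gs}b$ iff $a=b$, or $a\in G$ with $\nu$-value of $a$ $\geq$ that of $b$; for polynomials $\sum a_ix^i\models_{gs}\sum b_ix^i$ iff $a_i\models_{gs}b_i$ for all $i$. $\det(A)=\sum_{\sigma\in S_n}\prod_i a_{i,\sigma(i)}$; $A$ non-singular iff $\det(A)\in T$. $\operatorname{adj}(A)_{i,j}=\det(A_{j,i})$, $A^\nabla=\det(A)^{-1}\operatorname{adj}(A)$ for non-singular $A$. The characteristic polynomial $f_M(x)=\det(xI+M)\in R[x]$ is a formal polynomial whose coefficient of $x^k$ is the sum of the determinants of all $(n-k)\times(n-k)$ principal submatrices of $M$ (coefficient of $x^n$ is $1_R$). *)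

theory Defs
  imports "HOL-Combinatorics.Permutations"
begin

text \<open>The ordered abelian group is written additively (type class
linordered_ab_group_add); its elements are the nu-values. Tang g is the
tangible element g, Ghost g is its ghost g^nu, NegInf is the zero -infinity.\<close>

datatype 'g st = Tang 'g | Ghost 'g | NegInf

fun st_plus :: "'g::linordered_ab_group_add st \<Rightarrow> 'g st \<Rightarrow> 'g st" where
  "st_plus NegInf y = y"
| "st_plus x NegInf = x"
| "st_plus (Tang a) (Tang b) =
     (if a < b then Tang b else if b < a then Tang a else Ghost a)"
| "st_plus (Tang a) (Ghost b) = (if a \<le> b then Ghost b else Tang a)"
| "st_plus (Ghost a) (Tang b) = (if b \<le> a then Ghost a else Tang b)"
| "st_plus (Ghost a) (Ghost b) = Ghost (max a b)"

fun st_times :: "'g::linordered_ab_group_add st \<Rightarrow> 'g st \<Rightarrow> 'g st" where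
  "st_times NegInf y = NegInf"
| "st_times x NegInf = NegInf"
| "st_times (Tang a) (Tang b) = Tang (a + b)"
| "st_times (Tang a) (Ghost b) = Ghost (a + b)"
| "st_times (Ghost a) (Tang b) = Ghost (a + b)"
| "st_times (Ghost a) (Ghost b) = Ghost (a + b)"

instantiation st :: (linordered_ab_group_add) comm_monoid_add
begin
definition zero_st_def: "0 = NegInf"
definition plus_st_def: "x + y = st_plus x y"
instance
proof
  fix a b c :: "'a st"
  show "a + b + c = a + (b + c)"
    unfolding plus_st_def
    by (cases a; cases b; cases c) (auto simp: max_def)
  show "a + b = b + a"
    unfolding plus_st_def
    by (cases a; cases b) (auto simp: max.commute)
  show "0 + a = a" unfolding plus_st_def zero_st_def by simp
qed
end

instantiation st :: (linordered_ab_group_add) comm_monoid_mult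
begin
definition one_st_def: "1 = Tang 0"
definition times_st_def: "x * y = st_times x y"
instance
proof
  fix a b c :: "'a st"
  show "a * b * c = a * (b * c)"
    unfolding times_st_def
    by (cases a; cases b; cases c) (auto simp: add.assoc)
  show "a * b = b * a"
    unfolding times_st_def
    by (cases a; cases b) (auto simp: add.commute)
  show "1 * a = a" unfolding times_st_def one_st_def by (cases a) auto
qed
end

definition gs :: "'g::linordered_ab_group_add st \<Rightarrow> 'g st \<Rightarrow> bool" where
  "gs a b \<longleftrightarrow> a = b \<or>
     (\<exists>g. a = Ghost g \<and>
        (case b of NegInf \<Rightarrow> True | Tang h \<Rightarrow> h \<le> g | Ghost h \<Rightarrow> h \<le> g))"

text \<open>Polynomials are represented by coefficient sequences; ghost surpassing
of polynomials is coefficientwise.\<close>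

definition gs_poly :: "(nat \<Rightarrow> 'g::linordered_ab_group_add st) \<Rightarrow> (nat \<Rightarrow> 'g st) \<Rightarrow> bool" where
  "gs_poly f g \<longleftrightarrow> (\<forall>i. gs (f i) (g i))"

section \<open>n x n matrices (entries indexed by i, j < n)\<close>

type_synonym 'g smat = "nat \<Rightarrow> nat \<Rightarrow> 'g st"

definition det_on :: "nat set \<Rightarrow> 'g::linordered_ab_group_add smat \<Rightarrow> 'g st" where
  "det_on S M = (\<Sum>p\<in>{p. p permutes S}. \<Prod>i\<in>S. M i (p i))"

definition sdet :: "nat \<Rightarrow> 'g::linordered_ab_group_add smat \<Rightarrow> 'g st" where
  "sdet n M = det_on {..<n} M"

definition nonsingular :: "nat \<Rightarrow> 'g::linordered_ab_group_add smat \<Rightarrow> bool" where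
  "nonsingular n A \<longleftrightarrow> (\<exists>t. sdet n A = Tang t)"

text \<open>adj(A)_{i,j} = det(A_{j,i}) where A_{j,i} is A with row j and column i
deleted; its determinant is the sum over permutations s of {..<n} with
s j = i of the product over the remaining rows.\<close>
definition sadj :: "nat \<Rightarrow> 'g::linordered_ab_group_add smat \<Rightarrow> 'g smat" where
  "sadj n A i j = (\<Sum>s\<in>{s. s permutes {..<n} \<and> s j = i}. \<Prod>k\<in>{..<n} - {j}. A k (s k))"

definition st_inv :: "'g::linordered_ab_group_add st \<Rightarrow> 'g st" where
  "st_inv a = (case a of Tang t \<Rightarrow> Tang (- t) | Ghost t \<Rightarrow> Ghost (- t) | NegInf \<Rightarrow> NegInf)"

definition nabla :: "nat \<Rightarrow> 'g::linordered_ab_group_add smat \<Rightarrow> 'g smat" where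
  "nabla n A i j = st_inv (sdet n A) * sadj n A i j"

definition smult :: "nat \<Rightarrow> 'g::linordered_ab_group_add smat \<Rightarrow> 'g smat \<Rightarrow> 'g smat" where
  "smult n A B i j = (\<Sum>k<n. A i k * B k j)"

text \<open>Characteristic polynomial f_M(x) = det(xI + M), given by its
coefficients: coefficient of x^k is the sum of the determinants of all
(n-k) x (n-k) principal submatrices (coefficient of x^n is 1, of x^k for
k > n is the zero -infinity).\<close>
definition charpoly :: "nat \<Rightarrow> 'g::linordered_ab_group_add smat \<Rightarrow> nat \<Rightarrow> 'g st" where
  "charpoly n M k = (if k \<le> n then
      (\<Sum>S\<in>{S. S \<subseteq> {..<n} \<and> card S = n - k}. det_on S M) else 0)"

end

theory Submission
  imports "HOL-Library.Poly_Mapping" "HOL-Library.Product_Plus"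
    "Jordan_Normal_Form.Determinant" Defs
begin

text \<open>
  The proof transfers a determinant identity from commutative rings. Let the keys be pairs of a
  group element and a multiset of index pairs, and let Z[K] be their integral monoid ring. Sending
  each key to a product of a tangible element with entries of B, and each integer coefficient c to
  the |c|-fold sum of 1, gives a map absval from Z[K] to R. It is not additive or multiplicative,
  but cancellation always removes two copies of a monomial, so the sum (product) of the images
  ghost surpasses the image of the sum (product). Hence any expression over R ghost surpasses the
  image of the same expression over Z[K], in which signs may be inserted freely.

  Over Z[K], take generic B and let A consist of the monomials of its tangible entries. From
  A C = u B A, where C = t adj(A) B A, u = t det(A) and t is the monomial inverse to the value d of
  det(A) over R, one gets det(A) det(x I + C) = det(x I + u B) det(A), hence
  det(A) E(C) = det(A) u^m E(B) for the sums E of principal m x m minors. Since A is nonsingular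
  over R, a single permutation dominates det(A) strictly, so det(A) u^m is a signed monomial of
  value d plus terms of lower value. As the monomials of E(B) are distinct, the image of the
  right-hand side is exactly Tang d times the corresponding coefficient for B, and Tang d cancels.
\<close>

abbreviation keys where "keys \<equiv> Poly_Mapping.keys"
abbreviation lookup where "lookup \<equiv> Poly_Mapping.lookup"
abbreviation single where "single \<equiv> Poly_Mapping.single"

section \<open>Ghost surpassing and the absolute value map\<close>

text \<open>The semiring laws make \<open>of_nat\<close> available: \<open>of_nat m\<close> is
  \<open>NegInf\<close>, \<open>Tang 0\<close> or \<open>Ghost 0\<close> according to whether
  \<open>m\<close> is 0, 1 or larger, so it records whether a term is repeated.\<close>

instance st :: (linordered_ab_group_add) comm_semiring_1
proof
  fix a b c :: "'a st"
  show "(a + b) * c = a * c + b * c"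
    unfolding plus_st_def times_st_def
    by (cases a; cases b; cases c) (auto simp: max_def)
  show "0 * a = 0" "a * 0 = 0"
    unfolding zero_st_def times_st_def by (cases a; simp)+
  show "(0 :: 'a st) \<noteq> 1"
    unfolding zero_st_def one_st_def by simp
qed

text \<open>Doubling turns a tangible element into its ghost and fixes every other element. In this
  form, compatibility with sums and products is plain semiring algebra.\<close>

lemma gs_iff: "gs a b \<longleftrightarrow> (\<exists>c. a = b + c + c)"
proof
  assume "gs a b"
  then consider "a = b + 0 + 0"
    | g where "a = Ghost g" "case b of NegInf \<Rightarrow> True | Tang h \<Rightarrow> h \<le> g | Ghost h \<Rightarrow> h \<le> g"
    unfolding gs_def by auto
  then show "\<exists>c. a = b + c + c"
  proof cases
    case 1
    then show ?thesis by blast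
  next
    case 2
    \<comment> \<open>The doubled \<open>Tang g\<close> is \<open>Ghost g\<close>, which absorbs
      \<open>b\<close> because the value of \<open>b\<close> is at most \<open>g\<close>.\<close>
    then have "a = b + Tang g + Tang g"
      by (cases b) (auto simp: plus_st_def)
    then show ?thesis by blast
  qed
next
  assume "\<exists>c. a = b + c + c"
  then obtain c where "a = b + c + c" by blast
  then show "gs a b"
    unfolding gs_def by (cases b; cases c) (auto simp: plus_st_def max_def)
qed

lemma gs_refl [simp]: "gs a a"
  by (simp add: gs_def)

lemma gs_trans: "gs a b \<Longrightarrow> gs b c \<Longrightarrow> gs a c"
proof -
  assume "gs a b" "gs b c"
  then obtain x y where "a = b + x + x" "b = c + y + y"
    unfolding gs_iff by blast
  then have "a = c + (x + y) + (x + y)"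
    by (simp add: add_ac)
  then show ?thesis unfolding gs_iff by blast
qed

lemma gs_add: "gs a b \<Longrightarrow> gs c d \<Longrightarrow> gs (a + c) (b + d)"
proof -
  assume "gs a b" "gs c d"
  then obtain x y where "a = b + x + x" "c = d + y + y"
    unfolding gs_iff by blast
  then have "a + c = (b + d) + (x + y) + (x + y)"
    by (simp add: add_ac)
  then show ?thesis unfolding gs_iff by blast
qed

lemma gs_mult:
  assumes "gs a b" "gs c d"
  shows "gs (a * c) (b * d)"
proof -
  from assms obtain x y where "a = b + x + x" "c = d + y + y"
    unfolding gs_iff by blast
  then have "a * c = b * d + (x * d + b * y + x * y + x * y) + (x * d + b * y + x * y + x * y)"
    by (simp add: algebra_simps)
  then show ?thesis unfolding gs_iff by blast
qed

lemma gs_sum: "(\<And>x. x \<in> S \<Longrightarrow> gs (f x) (g x)) \<Longrightarrow> gs (sum f S) (sum g S)"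
  by (induction S rule: infinite_finite_induct) (auto intro: gs_add)

text \<open>The triangle inequality with a parity bonus: the defect of the inequality is an even
  number \<open>2 * m\<close>, so the surplus is a doubled element as in
  \<open>gs_iff\<close>.\<close>

lemma gs_of_nat_abs_add:
  fixes a b :: int
  shows "gs (of_nat (nat \<bar>a\<bar>) + of_nat (nat \<bar>b\<bar>)) (of_nat (nat \<bar>a + b\<bar>) :: 'g::linordered_ab_group_add st)"
proof -
  have "even (\<bar>a\<bar> + \<bar>b\<bar> - \<bar>a + b\<bar>)" "0 \<le> \<bar>a\<bar> + \<bar>b\<bar> - \<bar>a + b\<bar>"
    by auto
  then obtain m where "\<bar>a\<bar> + \<bar>b\<bar> = \<bar>a + b\<bar> + 2 * m" "m \<ge> 0"
    by (metis add_diff_cancel_left' diff_add_cancel dvdE zero_le_mult_iff zero_less_numeral not_numeral_le_zero add.commute)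
  then have "nat \<bar>a\<bar> + nat \<bar>b\<bar> = nat \<bar>a + b\<bar> + nat m + nat m"
    by linarith
  then show ?thesis
    unfolding gs_iff by (metis of_nat_add)
qed

text \<open>Signs are forgotten but multiplicities are kept: a coefficient of modulus 1 leaves
  \<open>\<phi> k\<close> unchanged, while a larger modulus makes a tangible value ghost.\<close>

definition absval :: "('k \<Rightarrow> 'g st) \<Rightarrow> ('k \<Rightarrow>\<^sub>0 int) \<Rightarrow> 'g::linordered_ab_group_add st" where
  "absval \<phi> p = (\<Sum>k\<in>keys p. of_nat (nat \<bar>lookup p k\<bar>) * \<phi> k)"

lemma absval_eq_sum_superset:
  assumes "finite K" "keys p \<subseteq> K"
  shows "absval \<phi> p = (\<Sum>k\<in>K. of_nat (nat \<bar>lookup p k\<bar>) * \<phi> k)"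
  unfolding absval_def using assms
  by (intro sum.mono_neutral_left) (auto simp: in_keys_iff)

lemma absval_0 [simp]: "absval \<phi> 0 = 0"
  by (simp add: absval_def)

lemma absval_single [simp]: "absval \<phi> (single k c) = of_nat (nat \<bar>c\<bar>) * \<phi> k"
  by (subst absval_eq_sum_superset[of "{k}"]) auto

lemma absval_uminus [simp]: "absval \<phi> (- p) = absval \<phi> p"
  by (simp add: absval_def)

lemma gs_absval_add: "gs (absval \<phi> p + absval \<phi> q) (absval \<phi> (p + q))"
proof -
  let ?K = "keys p \<union> keys q"
  have "absval \<phi> r = (\<Sum>k\<in>?K. of_nat (nat \<bar>lookup r k\<bar>) * \<phi> k)" if "keys r \<subseteq> ?K" for r
    by (rule absval_eq_sum_superset) (use that in auto)
  moreover have "keys (p + q) \<subseteq> ?K"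
    by (rule Poly_Mapping.keys_add)
  ultimately show ?thesis
    by (auto simp: lookup_add sum.distrib[symmetric] distrib_right[symmetric]
        intro!: gs_sum gs_mult gs_of_nat_abs_add)
qed

text \<open>Without common keys no coefficients can cancel, so surpassing improves to
  equality.\<close>

lemma absval_add_disjoint:
  assumes "keys p \<inter> keys q = {}"
  shows "absval \<phi> (p + q) = absval \<phi> p + absval \<phi> q"
proof -
  let ?K = "keys p \<union> keys q"
  have "absval \<phi> r = (\<Sum>k\<in>?K. of_nat (nat \<bar>lookup r k\<bar>) * \<phi> k)" if "keys r \<subseteq> ?K" for r
    by (rule absval_eq_sum_superset) (use that in auto)
  moreover have "keys (p + q) \<subseteq> ?K"
    by (rule Poly_Mapping.keys_add)
  moreover have "of_nat (nat \<bar>lookup p k + lookup q k\<bar>)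
      = (of_nat (nat \<bar>lookup p k\<bar>) + of_nat (nat \<bar>lookup q k\<bar>) :: 'b st)" for k
  proof (cases "k \<in> keys p")
    case True
    then have "k \<notin> keys q" using assms by blast
    then show ?thesis by (simp add: in_keys_iff)
  qed (simp add: in_keys_iff)
  ultimately show ?thesis
    by (simp add: lookup_add sum.distrib[symmetric] distrib_right[symmetric])
qed

lemma gs_absval_sum: "gs (\<Sum>x\<in>S. absval \<phi> (f x)) (absval \<phi> (\<Sum>x\<in>S. f x))"
  by (induction S rule: infinite_finite_induct)
    (auto intro: gs_trans[OF gs_add gs_absval_add])

lemma absval_sum_disjoint:
  assumes "finite S" "\<And>x y. x \<in> S \<Longrightarrow> y \<in> S \<Longrightarrow> x \<noteq> y \<Longrightarrow> keys (f x) \<inter> keys (f y) = {}"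
  shows "absval \<phi> (\<Sum>x\<in>S. f x) = (\<Sum>x\<in>S. absval \<phi> (f x))"
  using assms
proof (induction S)
  case (insert x S)
  have "keys (sum f S) \<subseteq> (\<Union>y\<in>S. keys (f y))"
    by (rule keys_sum)
  moreover have "keys (f x) \<inter> (\<Union>y\<in>S. keys (f y)) = {}"
    using insert by blast
  ultimately have "keys (f x) \<inter> keys (sum f S) = {}"
    by blast
  then show ?case
    using insert by (simp add: absval_add_disjoint)
qed simp

lemma poly_mapping_eq_sum_single: "p = (\<Sum>k\<in>keys p. single k (lookup p k))"
  by (rule poly_mapping_eqI) (auto simp: lookup_sum lookup_single when_def in_keys_iff)

text \<open>Before equal keys are collected, the products of single terms match exactly; only the
  collection loses information, and \<open>gs_absval_sum\<close> controls it.\<close>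

lemma gs_absval_mult:
  fixes p q :: "'k::monoid_add \<Rightarrow>\<^sub>0 int"
  assumes hom: "\<And>k l. \<phi> (k + l) = \<phi> k * \<phi> l"
  shows "gs (absval \<phi> p * absval \<phi> q) (absval \<phi> (p * q))"
proof -
  let ?f = "\<lambda>(k, l). single k (lookup p k) * single l (lookup q l)"
  let ?K = "keys p \<times> keys q"
  have "p * q = (\<Sum>k\<in>keys p. single k (lookup p k)) * (\<Sum>l\<in>keys q. single l (lookup q l))"
    using poly_mapping_eq_sum_single[of p] poly_mapping_eq_sum_single[of q] by simp
  also have "\<dots> = sum ?f ?K"
    by (simp add: sum_product sum.cartesian_product)
  finally have pq: "p * q = sum ?f ?K" .
  have "absval \<phi> p * absval \<phi> q = (\<Sum>x\<in>?K. absval \<phi> (?f x))"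
    unfolding absval_def[of \<phi> p] absval_def[of \<phi> q] sum_product sum.cartesian_product
    by (rule sum.cong) (auto simp: mult_single hom abs_mult nat_mult_distrib mult_ac)
  then show ?thesis
    unfolding pq using gs_absval_sum[of \<phi> ?f ?K] by simp
qed

text \<open>Translation by \<open>l\<close> is injective on keys, so the translated terms stay
  disjoint and equality holds.\<close>

lemma absval_mult_single:
  fixes p :: "'k::cancel_comm_monoid_add \<Rightarrow>\<^sub>0 int"
  assumes hom: "\<And>k l. \<phi> (k + l) = \<phi> k * \<phi> l" and c: "\<bar>c\<bar> = 1"
  shows "absval \<phi> (single l c * p) = \<phi> l * absval \<phi> p"
proof -
  let ?f = "\<lambda>k. single (l + k) (c * lookup p k)"
  have "single l c * p = single l c * (\<Sum>k\<in>keys p. single k (lookup p k))"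
    by (simp flip: poly_mapping_eq_sum_single)
  also have "\<dots> = sum ?f (keys p)"
    by (simp add: sum_distrib_left mult_single)
  also have "absval \<phi> \<dots> = (\<Sum>k\<in>keys p. absval \<phi> (?f k))"
    by (rule absval_sum_disjoint) auto
  also have "\<dots> = \<phi> l * absval \<phi> p"
    unfolding absval_def[of \<phi> p] sum_distrib_left
    by (rule sum.cong) (auto simp: hom abs_mult c mult_ac)
  finally show ?thesis .
qed

section \<open>Principal minors over a commutative ring\<close>

lemma permutes_nat_less: "p permutes {..<n::nat} \<Longrightarrow> i < n \<Longrightarrow> p i < n"
  using permutes_in_image[of p "{..<n}" i] by simp

text \<open>Together with \<open>minor_sum\<close> and \<open>adjugate\<close>, this is a signed
  counterpart of the supertropical notions, over the same index sets, so that the two sides can be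
  compared term by term.\<close>

definition minor :: "nat set \<Rightarrow> (nat \<Rightarrow> nat \<Rightarrow> 'a) \<Rightarrow> 'a::comm_ring_1" where
  "minor S M = (\<Sum>p | p permutes S. of_int (sign p) * (\<Prod>i\<in>S. M i (p i)))"

definition minor_sum :: "nat \<Rightarrow> (nat \<Rightarrow> nat \<Rightarrow> 'a) \<Rightarrow> nat \<Rightarrow> 'a::comm_ring_1" where
  "minor_sum n M m = (\<Sum>S | S \<subseteq> {..<n} \<and> card S = m. minor S M)"

definition adjugate :: "nat \<Rightarrow> (nat \<Rightarrow> nat \<Rightarrow> 'a) \<Rightarrow> nat \<Rightarrow> nat \<Rightarrow> 'a::comm_ring_1" where
  "adjugate n A i j =
    (\<Sum>s | s permutes {..<n} \<and> s j = i. of_int (sign s) * (\<Prod>k\<in>{..<n} - {j}. A k (s k)))"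

text \<open>Bridge to the library determinant, from which multiplicativity and vanishing for equal
  rows are inherited.\<close>

lemma det_mat_eq_minor: "det (mat n n (\<lambda>(i, j). M i j)) = minor {..<n} M"
  unfolding minor_def
  by (subst det_def'[of _ n]) (auto simp: atLeast0LessThan permutes_nat_less intro!: sum.cong prod.cong)

lemma minor_cong:
  assumes "\<And>i j. i \<in> S \<Longrightarrow> j \<in> S \<Longrightarrow> M i j = N i j"
  shows "minor S M = minor S N"
  unfolding minor_def using assms
  by (auto intro!: sum.cong prod.cong arg_cong2[of _ _ _ _ "(*)"] simp: permutes_in_image)

lemma minor_mult:
  "minor {..<n} (\<lambda>i j. \<Sum>k<n. A i k * B k j) = minor {..<n} A * minor {..<n} B"
proof -
  have "mat n n (\<lambda>(i, j). \<Sum>k<n. A i k * B k j)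
      = mat n n (\<lambda>(i, j). A i j) * mat n n (\<lambda>(i, j). B i j)"
    by (rule eq_matI) (auto simp: scalar_prod_def atLeast0LessThan)
  then show ?thesis
    by (simp flip: det_mat_eq_minor add: det_mult[of _ n])
qed

lemma minor_identical_rows:
  assumes "i < n" "l < n" "i \<noteq> l" "\<And>j. j < n \<Longrightarrow> A i j = A l j"
  shows "minor {..<n} A = 0"
  unfolding det_mat_eq_minor[symmetric]
  by (rule det_identical_rows[of _ n i l]) (use assms in \<open>auto intro!: eq_vecI\<close>)

lemma minor_scale: "minor S (\<lambda>i j. c * M i j) = c ^ card S * minor S M"
  unfolding minor_def by (simp add: prod.distrib sum_distrib_left mult_ac)

lemma minor_sum_scale: "minor_sum n (\<lambda>i j. c * M i j) m = c ^ m * minor_sum n M m"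
  unfolding minor_sum_def minor_scale by (simp add: sum_distrib_left)

text \<open>Laplace expansion along row \<open>l\<close> of the matrix \<open>A\<close> with row
  \<open>l\<close> replaced by row \<open>i\<close>; for distinct \<open>i\<close> and
  \<open>l\<close> that matrix has two equal rows.\<close>

lemma mult_adjugate:
  assumes "i < n" "l < n"
  shows "(\<Sum>j<n. A i j * adjugate n A j l) = (if i = l then minor {..<n} A else 0)"
proof -
  let ?A = "A(l := A i)"
  let ?P = "{s. s permutes {..<n}}"
  let ?f = "\<lambda>s. of_int (sign s) * (A i (s l) * (\<Prod>k\<in>{..<n} - {l}. A k (s k)))"
  have "(\<Sum>j<n. A i j * adjugate n A j l)
      = (\<Sum>j<n. \<Sum>s | s \<in> ?P \<and> s l = j. ?f s)"
    unfolding adjugate_def sum_distrib_left by (auto intro!: sum.cong simp: mult_ac)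
  \<comment> \<open>The inner sums group the permutations by their value at
    \<open>l\<close>.\<close>
  also have "\<dots> = (\<Sum>s\<in>?P. ?f s)"
    by (rule sum.group) (use assms in \<open>auto simp: finite_permutations permutes_nat_less\<close>)
  also have "\<dots> = minor {..<n} ?A"
    unfolding minor_def
  proof (intro sum.cong refl arg_cong2[of _ _ _ _ "(*)"])
    fix s
    show "A i (s l) * (\<Prod>k\<in>{..<n} - {l}. A k (s k)) = (\<Prod>k<n. ?A k (s k))"
      using assms by (subst prod.remove[of _ l]) (auto intro!: prod.cong)
  qed
  also have "\<dots> = (if i = l then minor {..<n} A else 0)"
    using assms by (auto intro!: minor_identical_rows[of i n l])
  finally show ?thesis .
qed

section \<open>The characteristic polynomial as generating function of principal minors\<close>

lemma minor_add_diagonal: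
  "minor {..<n} (\<lambda>i j. (if i = j then x else 0) + M i j)
    = (\<Sum>S\<in>Pow {..<n}. x ^ (n - card S) * minor S M)"
proof -
  let ?P = "{p. p permutes {..<n}}"
  have expand: "(\<Prod>i<n. (if i = p i then x else 0) + M i (p i))
      = (\<Sum>S\<in>Pow {..<n}. if \<forall>i\<in>{..<n} - S. p i = i
           then x ^ (n - card S) * (\<Prod>i\<in>S. M i (p i)) else 0)" for p
  proof -
    have "(\<Prod>i<n. (if i = p i then x else 0) + M i (p i))
        = (\<Prod>i<n. M i (p i) + (if i = p i then x else 0))"
      by (simp add: add.commute)
    \<comment> \<open>Here \<open>S\<close> is the set of rows in which the entry of
      \<open>M\<close> is chosen; the other rows contribute \<open>x\<close> and must be fixed by
      \<open>p\<close>.\<close>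
    also have "\<dots> = (\<Sum>S\<in>Pow {..<n}. (\<Prod>i\<in>S. M i (p i)) * (\<Prod>i\<in>{..<n} - S. if i = p i then x else 0))"
      by (rule prod_add) simp
    also have "\<dots> = (\<Sum>S\<in>Pow {..<n}. if \<forall>i\<in>{..<n} - S. p i = i
           then x ^ (n - card S) * (\<Prod>i\<in>S. M i (p i)) else 0)"
    proof (rule sum.cong)
      fix S assume "S \<in> Pow {..<n}"
      then have S: "S \<subseteq> {..<n}" by simp
      show "(\<Prod>i\<in>S. M i (p i)) * (\<Prod>i\<in>{..<n} - S. if i = p i then x else 0)
          = (if \<forall>i\<in>{..<n} - S. p i = i then x ^ (n - card S) * (\<Prod>i\<in>S. M i (p i)) else 0)"
      proof (cases "\<forall>i\<in>{..<n} - S. p i = i")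
        case True
        then have "(\<Prod>i\<in>{..<n} - S. if i = p i then x else 0) = x ^ card ({..<n} - S)"
          by (simp flip: prod_constant)
        with True S show ?thesis
          by (simp add: card_Diff_subset finite_subset mult.commute)
      next
        case False
        then obtain i where "i \<in> {..<n} - S" "i \<noteq> p i"
          by force
        then have "(\<Prod>i\<in>{..<n} - S. if i = p i then x else 0) = 0"
          by (intro prod_zero) auto
        then show ?thesis
          unfolding if_not_P[OF False] by simp
      qed
    qed simp
    finally show ?thesis .
  qed
  have "minor {..<n} (\<lambda>i j. (if i = j then x else 0) + M i j)
      = (\<Sum>p\<in>?P. \<Sum>S\<in>Pow {..<n}. if \<forall>i\<in>{..<n} - S. p i = i
           then x ^ (n - card S) * (of_int (sign p) * (\<Prod>i\<in>S. M i (p i))) else 0)"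
    unfolding minor_def expand sum_distrib_left
    by (intro sum.cong refl) (auto simp: mult_ac)
  also have "\<dots> = (\<Sum>S\<in>Pow {..<n}. \<Sum>p\<in>?P. if \<forall>i\<in>{..<n} - S. p i = i
           then x ^ (n - card S) * (of_int (sign p) * (\<Prod>i\<in>S. M i (p i))) else 0)"
    by (rule sum.swap)
  also have "\<dots> = (\<Sum>S\<in>Pow {..<n}. x ^ (n - card S) * minor S M)"
  proof (rule sum.cong)
    fix S assume "S \<in> Pow {..<n}"
    \<comment> \<open>The surviving permutations are exactly those of \<open>S\<close>, which turns
      the inner sum into a principal minor.\<close>
    then have *: "{p. p permutes S} = {p \<in> ?P. \<forall>i\<in>{..<n} - S. p i = i}"
      by (auto intro: permutes_subset permutes_superset dest: permutes_not_in)
    show "(\<Sum>p\<in>?P. if \<forall>i\<in>{..<n} - S. p i = i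
           then x ^ (n - card S) * (of_int (sign p) * (\<Prod>i\<in>S. M i (p i))) else 0)
        = x ^ (n - card S) * minor S M"
      unfolding minor_def sum_distrib_left *
      by (subst sum.inter_filter) (auto simp: finite_permutations)
  qed simp
  finally show ?thesis .
qed

lemma minor_const_poly: "minor S (\<lambda>i j. [:M i j:]) = [:minor S M:]"
proof -
  interpret comm_ring_hom "\<lambda>c. [:c:] :: 'a poly"
    by unfold_locales (auto simp: one_pCons mult.commute)
  show ?thesis
    by (simp add: minor_def hom_sum hom_mult hom_prod hom_of_int)
qed

lemma coeff_minor_add_diagonal:
  assumes "m \<le> n"
  shows "coeff (minor {..<n} (\<lambda>i j. (if i = j then [:0, 1:] else 0) + [:M i j:])) (n - m)
    = minor_sum n M m"
proof -
  have "coeff (minor {..<n} (\<lambda>i j. (if i = j then [:0, 1:] else 0) + [:M i j:])) (n - m)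
      = (\<Sum>S\<in>Pow {..<n}. if card S = m then minor S M else 0)"
    unfolding minor_add_diagonal minor_const_poly coeff_sum
  proof (intro sum.cong refl)
    fix S assume "S \<in> Pow {..<n}"
    \<comment> \<open>With both \<open>card S\<close> and \<open>m\<close> at most \<open>n\<close>,
      truncated subtraction is harmless: the exponents agree only if
      \<open>card S = m\<close>.\<close>
    then have "card S \<le> n"
      using card_mono[of "{..<n}" S] by auto
    moreover have "[:0, 1:] ^ (n - card S) * [:minor S M:] = monom (minor S M) (n - card S)"
      by (simp add: monom_altdef mult.commute)
    ultimately show "coeff ([:0, 1:] ^ (n - card S) * [:minor S M:]) (n - m)
        = (if card S = m then minor S M else 0)"
      using assms by auto
  qed
  also have "\<dots> = minor_sum n M m"
    unfolding minor_sum_def by (subst sum.inter_filter[symmetric]) (auto intro!: sum.cong)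
  finally show ?thesis .
qed

text \<open>The indeterminate is central, so \<open>A\<close> also intertwines
  \<open>x I + C\<close> and \<open>x I + B\<close>; taking determinants and comparing coefficients
  gives the claim. The factor \<open>minor {..<n} A\<close> stays on both sides, since it need not
  be cancellable.\<close>

lemma minor_sum_intertwine:
  fixes A B C :: "nat \<Rightarrow> nat \<Rightarrow> 'a::comm_ring_1"
  assumes AC: "\<And>i j. i < n \<Longrightarrow> j < n \<Longrightarrow> (\<Sum>k<n. A i k * C k j) = (\<Sum>k<n. B i k * A k j)"
    and m: "m \<le> n"
  shows "minor {..<n} A * minor_sum n C m = minor {..<n} A * minor_sum n B m"
proof -
  let ?X = "\<lambda>(M :: nat \<Rightarrow> nat \<Rightarrow> 'a) i j. (if i = j then [:0, 1:] else 0) + [:M i j:]"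
  have const: "(\<Sum>k<n. [:f k:] * [:g k:]) = [:\<Sum>k<n. f k * g k:]" for f g :: "nat \<Rightarrow> 'a"
    by (induction n) (auto simp: mult.commute)
  have "[:minor {..<n} A:] * minor {..<n} (?X C)
      = minor {..<n} (\<lambda>i j. \<Sum>k<n. [:A i k:] * ?X C k j)"
    by (simp only: minor_mult minor_const_poly)
  also have "\<dots> = minor {..<n} (\<lambda>i j. \<Sum>k<n. ?X B i k * [:A k j:])"
  proof (rule minor_cong)
    fix i j assume ij: "i \<in> {..<n}" "j \<in> {..<n}"
    have "(\<Sum>k<n. [:A i k:] * ?X C k j) = [:A i j:] * [:0, 1:] + [:\<Sum>k<n. A i k * C k j:]"
      using ij by (simp only: distrib_left sum.distrib const) (simp add: if_distrib if_distribR sum.delta cong: if_cong)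
    also have "\<dots> = [:0, 1:] * [:A i j:] + [:\<Sum>k<n. B i k * A k j:]"
      using AC ij by (simp add: mult.commute)
    also have "\<dots> = (\<Sum>k<n. ?X B i k * [:A k j:])"
      using ij by (simp only: distrib_right sum.distrib const) (simp add: if_distrib if_distribR sum.delta cong: if_cong)
    finally show "(\<Sum>k<n. [:A i k:] * ?X C k j) = (\<Sum>k<n. ?X B i k * [:A k j:])" .
  qed
  also have "\<dots> = minor {..<n} (?X B) * [:minor {..<n} A:]"
    by (simp only: minor_mult minor_const_poly)
  finally have "coeff ([:minor {..<n} A:] * minor {..<n} (?X C)) (n - m)
      = coeff ([:minor {..<n} A:] * minor {..<n} (?X B)) (n - m)"
    by (simp add: mult.commute)
  then show ?thesis
    by (simp add: coeff_minor_add_diagonal[OF m])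
qed

section \<open>Representing supertropical elements in the monoid ring\<close>

text \<open>Evaluation of a monomial: the multiset lists formal indeterminates, specialised through
  \<open>b\<close>. Keeping them formal prevents different products of entries from merging when
  their values agree.\<close>

definition weight :: "('v \<Rightarrow> 'g st) \<Rightarrow> 'g \<times> 'v multiset \<Rightarrow> 'g::linordered_ab_group_add st" where
  "weight b k = Tang (fst k) * (\<Prod>x\<in>#snd k. b x)"

lemma Tang_add: "Tang (a + b) = Tang a * Tang b"
  by (simp add: times_st_def)

lemma weight_add: "weight b (k + l) = weight b k * weight b l"
  by (simp add: weight_def Tang_add mult_ac)

definition represents ::
    "('v \<Rightarrow> 'g st) \<Rightarrow> 'g::linordered_ab_group_add st \<Rightarrow> ('g \<times> 'v multiset \<Rightarrow>\<^sub>0 int) \<Rightarrow> bool" where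
  "represents b r p \<longleftrightarrow> gs r (absval (weight b) p)"

lemma represents_single: "represents b (weight b k) (single k 1)"
  by (simp add: represents_def)

lemma represents_0: "represents b 0 0"
  by (simp add: represents_def)

lemma represents_1: "represents b 1 1"
proof -
  have "weight b 0 = 1"
    by (simp add: weight_def one_st_def times_st_def)
  then show ?thesis
    using represents_single[of b 0] by (simp flip: single_one)
qed

lemma represents_add: "represents b r p \<Longrightarrow> represents b s q \<Longrightarrow> represents b (r + s) (p + q)"
  unfolding represents_def by (rule gs_trans[OF gs_add gs_absval_add])

lemma represents_mult: "represents b r p \<Longrightarrow> represents b s q \<Longrightarrow> represents b (r * s) (p * q)"
  unfolding represents_def by (rule gs_trans[OF gs_mult gs_absval_mult]) (auto simp: weight_add)

text \<open>Since \<open>absval\<close> ignores negation, unsigned supertropical determinants may be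
  represented by signed ones.\<close>

lemma represents_sign: "represents b r p \<Longrightarrow> represents b r (of_int (sign \<pi>) * p)"
  by (simp add: represents_def sign_def)

lemma represents_sum:
  "(\<And>x. x \<in> S \<Longrightarrow> represents b (f x) (g x)) \<Longrightarrow> represents b (sum f S) (sum g S)"
  by (induction S rule: infinite_finite_induct) (auto intro: represents_0 represents_add)

lemma represents_prod:
  "(\<And>x. x \<in> S \<Longrightarrow> represents b (f x) (g x)) \<Longrightarrow> represents b (prod f S) (prod g S)"
  by (induction S rule: infinite_finite_induct) (auto intro: represents_1 represents_mult)

lemma represents_det_on:
  assumes "\<And>i j. i \<in> S \<Longrightarrow> j \<in> S \<Longrightarrow> represents b (M i j) (N i j)"
  shows "represents b (det_on S M) (minor S N)"
  unfolding det_on_def minor_def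
  by (intro represents_sum represents_sign represents_prod assms) (auto simp: permutes_in_image)

lemma represents_sadj:
  assumes "\<And>i j. i < n \<Longrightarrow> j < n \<Longrightarrow> represents b (M i j) (N i j)"
  shows "represents b (sadj n M i j) (adjugate n N i j)"
  unfolding sadj_def adjugate_def
  by (intro represents_sum represents_sign represents_prod assms) (auto simp: permutes_nat_less)

lemma represents_charpoly:
  assumes "\<And>i j. i < n \<Longrightarrow> j < n \<Longrightarrow> represents b (M i j) (N i j)" "k \<le> n"
  shows "represents b (charpoly n M k) (minor_sum n N (n - k))"
  unfolding charpoly_def minor_sum_def using assms(2)
  by (auto intro!: represents_sum represents_det_on assms(1))

section \<open>Elements with a unit leading coefficient\<close>

text \<open>The equation Tang d + r = Tang d expresses that r lies strictly below Tang d.\<close>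

lemma Tang_add_absorb_left:
  "Tang d + (r + s) = Tang d \<Longrightarrow> Tang d + r = (Tang d :: 'g::linordered_ab_group_add st)"
  by (cases r; cases s) (auto simp: plus_st_def max_def split: if_splits)

text \<open>A tie or a dominant ghost would make the sum ghost, so one summand is the sum and the
  other lies strictly below it.\<close>

lemma add_eq_Tang:
  "r + s = Tang d \<Longrightarrow> r = Tang d \<and> Tang d + s = Tang d \<or> s = Tang d \<and> Tang d + r = Tang d"
  by (cases r; cases s) (auto simp: plus_st_def split: if_splits)

lemma Tang_add_absorb_sum:
  assumes "finite S" "Tang d + sum f S = Tang d" "x \<in> S"
  shows "Tang d + f x = Tang d"
  using assms by (auto simp: sum.remove intro: Tang_add_absorb_left)

lemma sum_eq_Tang:
  assumes "finite S" "sum f S = Tang d"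
  shows "\<exists>x\<in>S. f x = Tang d \<and> (\<forall>y\<in>S - {x}. Tang d + f y = Tang d)"
  using assms
proof (induction S)
  case empty
  then show ?case by (simp add: zero_st_def)
next
  case (insert x S)
  then have "f x + sum f S = Tang d"
    by simp
  from add_eq_Tang[OF this] show ?case
  proof
    assume "f x = Tang d \<and> Tang d + sum f S = Tang d"
    then have "f x = Tang d \<and> (\<forall>y\<in>insert x S - {x}. Tang d + f y = Tang d)"
      using Tang_add_absorb_sum[OF insert.hyps(1)] by auto
    then show ?thesis by blast
  next
    assume *: "sum f S = Tang d \<and> Tang d + f x = Tang d"
    then obtain z where "z \<in> S" "f z = Tang d" "\<forall>y\<in>S - {z}. Tang d + f y = Tang d"
      using insert.IH by blast
    with * have "z \<in> insert x S" "f z = Tang d \<and> (\<forall>y\<in>insert x S - {z}. Tang d + f y = Tang d)"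
      by auto
    then show ?thesis by blast
  qed
qed

text \<open>A ghost surpasses 0, so ghost entries may be represented by 0.\<close>

definition tang_part ::
    "'g st \<Rightarrow> ('g::linordered_ab_group_add \<times> 'v multiset \<Rightarrow>\<^sub>0 int)" where
  "tang_part r = (case r of Tang g \<Rightarrow> single (g, {#}) 1 | _ \<Rightarrow> 0)"

lemma represents_tang_part: "represents b r (tang_part r)"
proof (cases r)
  case (Tang g)
  then show ?thesis
    using represents_single[of b "(g, {#})"] by (simp add: tang_part_def weight_def)
qed (simp_all add: represents_def tang_part_def gs_def zero_st_def)

lemma tang_part_mult: "tang_part (r * s) = tang_part r * tang_part s"
  by (cases r; cases s) (auto simp: tang_part_def times_st_def mult_single)

lemma tang_part_1: "tang_part 1 = 1"
  unfolding tang_part_def one_st_def by (simp add: zero_prod_def flip: single_one)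

lemma tang_part_prod: "tang_part (prod f S) = (\<Prod>x\<in>S. tang_part (f x))"
  by (induction S rule: infinite_finite_induct) (auto simp: tang_part_1 tang_part_mult)

lemma keys_tang_part_absorbed:
  "k \<in> keys (tang_part r) \<Longrightarrow> Tang d + r = Tang d \<Longrightarrow> fst k < d \<and> snd k = {#}"
  by (cases r) (auto simp: tang_part_def plus_st_def split: if_splits)

text \<open>The leading term is taken with respect to the group component. Its coefficient is a
  sign, so it stays tangible under \<open>absval\<close>, and the empty multisets exclude all
  indeterminates.\<close>

definition unit_leading ::
    "'g \<Rightarrow> ('g::linordered_ab_group_add \<times> 'v multiset \<Rightarrow>\<^sub>0 int) \<Rightarrow> bool" where
  "unit_leading d w \<longleftrightarrow> (\<exists>c q. \<bar>c\<bar> = 1 \<and> w = single (d, {#}) c + q \<and>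
     (\<forall>k\<in>keys q. fst k < d \<and> snd k = {#}))"

lemma unit_leading_single: "unit_leading d (single (d, {#}) 1)"
  unfolding unit_leading_def by (intro exI[of _ 1] exI[of _ 0]) auto

lemma in_keys_addE:
  assumes "k \<in> keys (p + q)"
  obtains "k \<in> keys p" | "k \<in> keys q"
  using assms Poly_Mapping.keys_add[of p q] by blast

lemma unit_leading_keys:
  assumes "unit_leading d w" "k \<in> keys w"
  shows "snd k = {#}"
proof -
  from assms(1) obtain c q where "w = single (d, {#}) c + q" "\<forall>k\<in>keys q. snd k = {#}"
    unfolding unit_leading_def by blast
  moreover from this have "k \<in> keys (single (d, {#}) c) \<or> k \<in> keys q"
    using assms(2) by (auto elim: in_keys_addE)
  ultimately show ?thesis
    by (auto split: if_splits)
qed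

text \<open>The leading terms multiply to a leading term; every other product involves a strictly
  smaller factor, hence has strictly smaller value.\<close>

lemma unit_leading_mult:
  assumes "unit_leading d v" "unit_leading e w"
  shows "unit_leading (d + e) (v * w)"
proof -
  from assms(1) obtain a p where a: "\<bar>a\<bar> = 1" "v = single (d, {#}) a + p"
    and p: "\<And>k. k \<in> keys p \<Longrightarrow> fst k < d \<and> snd k = {#}"
    unfolding unit_leading_def by blast
  from assms(2) obtain c q where c: "\<bar>c\<bar> = 1" "w = single (e, {#}) c + q"
    and q: "\<And>k. k \<in> keys q \<Longrightarrow> fst k < e \<and> snd k = {#}"
    unfolding unit_leading_def by blast
  let ?r = "single (d, {#}) a * q + (p * single (e, {#}) c + p * q)"
  have "v * w = single (d + e, {#}) (a * c) + ?r"
    unfolding a(2) c(2) by (simp add: distrib_left distrib_right mult_single add_ac)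
  moreover have "fst k < d + e \<and> snd k = {#}" if "k \<in> keys ?r" for k
  proof -
    have prod: "\<exists>x\<in>keys f. \<exists>y\<in>keys g. k = x + y" if "k \<in> keys (f * g)"
      for f g :: "'a \<times> 'b multiset \<Rightarrow>\<^sub>0 int"
      using that keys_mult[of f g] by blast
    have "k \<in> keys (single (d, {#}) a * q) \<or> k \<in> keys (p * single (e, {#}) c) \<or> k \<in> keys (p * q)"
      using that by (elim in_keys_addE) blast+
    then consider y where "y \<in> keys q" "k = (d, {#}) + y"
      | x where "x \<in> keys p" "k = x + (e, {#})"
      | x y where "x \<in> keys p" "y \<in> keys q" "k = x + y"
      by (elim disjE) (auto dest!: prod split: if_splits)
    then show ?thesis
      by cases (auto dest!: p q simp: add_strict_mono)
  qed
  ultimately show ?thesis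
    unfolding unit_leading_def using a(1) c(1)
    by (intro exI[of _ "a * c"] exI[of _ ?r]) (auto simp: abs_mult)
qed

lemma unit_leading_power: "unit_leading 0 w \<Longrightarrow> unit_leading 0 (w ^ m)"
proof (induction m)
  case 0
  then show ?case
    using unit_leading_single[of 0] by (simp add: zero_prod_def flip: single_one)
next
  case (Suc m)
  then show ?case
    using unit_leading_mult[of 0 w 0 "w ^ m"] by simp
qed

lemma absval_unit_leading:
  assumes "unit_leading d w"
  shows "absval (weight b) w = Tang d"
proof -
  from assms obtain c q where c: "\<bar>c\<bar> = 1" "w = single (d, {#}) c + q"
    and q: "\<And>k. k \<in> keys q \<Longrightarrow> fst k < d \<and> snd k = {#}"
    unfolding unit_leading_def by blast
  \<comment> \<open>A lower term is absorbed whatever its multiplicity, even if the multiplicity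
    makes it ghost.\<close>
  have absorb: "Tang d + of_nat m * Tang g = Tang d" if "g < d" for g m
  proof (induction m)
    case (Suc m)
    have "Tang d + Tang g = Tang d"
      using that by (auto simp: plus_st_def)
    with Suc show ?case
      by (simp add: distrib_right flip: add.assoc)
  qed simp
  have "Tang d + (\<Sum>k\<in>K. of_nat (nat \<bar>lookup q k\<bar>) * weight b k) = Tang d"
    if "finite K" "K \<subseteq> keys q" for K
    using that
    by (induction K) (auto simp: absorb weight_def dest!: q simp flip: add.assoc)
  moreover have "keys (single (d, {#}) c) \<inter> keys q = {}"
    using q[of "(d, {#})"] by auto
  ultimately show ?thesis
    unfolding c(2) using c(1)
    by (simp add: absval_add_disjoint absval_def[of _ q] weight_def)
qed

text \<open>A tangible determinant has exactly one dominant permutation by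
  \<open>sum_eq_Tang\<close>; its sign is the leading coefficient.\<close>

lemma unit_leading_minor:
  assumes "sdet n A = Tang d"
  shows "unit_leading d (minor {..<n} (\<lambda>i j. tang_part (A i j)))"
proof -
  let ?P = "{p. p permutes {..<n}}"
  let ?f = "\<lambda>p. \<Prod>i<n. A i (p i)"
  let ?g = "\<lambda>p. of_int (sign p) * tang_part (?f p) :: 'a \<times> 'b multiset \<Rightarrow>\<^sub>0 int"
  have fin: "finite ?P"
    by (simp add: finite_permutations)
  obtain p where p: "p \<in> ?P" "?f p = Tang d" "\<And>s. s \<in> ?P - {p} \<Longrightarrow> Tang d + ?f s = Tang d"
    using sum_eq_Tang[OF fin, of ?f d] assms unfolding sdet_def det_on_def by blast
  have "minor {..<n} (\<lambda>i j. tang_part (A i j)) = sum ?g ?P"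
    unfolding minor_def by (simp add: tang_part_prod)
  also have "\<dots> = ?g p + sum ?g (?P - {p})"
    by (rule sum.remove[OF fin p(1)])
  also have "?g p = single (d, {#}) (sign p)"
    by (simp add: p(2) tang_part_def sign_def single_uminus)
  finally have "minor {..<n} (\<lambda>i j. tang_part (A i j))
      = single (d, {#}) (sign p) + sum ?g (?P - {p})" .
  moreover have "fst k < d \<and> snd k = {#}" if "k \<in> keys (sum ?g (?P - {p}))" for k
  proof -
    from that obtain s where s: "s \<in> ?P - {p}" "k \<in> keys (?g s)"
      using keys_sum[of ?g "?P - {p}"] by blast
    then have "k \<in> keys (tang_part (?f s) :: 'a \<times> 'b multiset \<Rightarrow>\<^sub>0 int)"
      by (auto simp: sign_def split: if_splits)
    then show ?thesis
      using p(3)[OF s(1)] by (rule keys_tang_part_absorbed)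
  qed
  ultimately show ?thesis
    unfolding unit_leading_def
    by (intro exI[of _ "sign p"] exI[of _ "sum ?g (?P - {p})"]) (auto simp: sign_def)
qed

section \<open>Distinct monomials in the principal minors of a generic matrix\<close>

definition graph_mset :: "nat set \<Rightarrow> (nat \<Rightarrow> nat) \<Rightarrow> (nat \<times> nat) multiset" where
  "graph_mset S p = (\<Sum>i\<in>S. {#(i, p i)#})"

lemma set_graph_mset: "finite S \<Longrightarrow> set_mset (graph_mset S p) = (\<lambda>i. (i, p i)) ` S"
  unfolding graph_mset_def by (induction S rule: finite_induct) auto

text \<open>First coordinates recover the set, the pairs recover the permutation on it, and outside
  it both permutations are the identity.\<close>

lemma graph_mset_inj:
  assumes "finite S" "finite T" "p permutes S" "q permutes T" "graph_mset S p = graph_mset T q"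
  shows "S = T \<and> p = q"
proof -
  have eq: "(\<lambda>i. (i, p i)) ` S = (\<lambda>i. (i, q i)) ` T"
    using assms(1,2,5) by (metis set_graph_mset)
  from arg_cong[OF this, of "image fst"] have "S = T"
    by (simp add: image_image)
  moreover have "p i = q i" for i
    using eq assms(3,4) \<open>S = T\<close> by (cases "i \<in> S") (auto simp: permutes_not_in)
  ultimately show ?thesis by blast
qed

lemma weight_graph_mset:
  "weight b (0, graph_mset S p) = (\<Prod>i\<in>S. b (i, p i))"
proof -
  have "(\<Prod>x\<in>#graph_mset S p. b x) = (\<Prod>i\<in>S. b (i, p i))"
    unfolding graph_mset_def by (induction S rule: infinite_finite_induct) auto
  then show ?thesis
    by (simp add: weight_def flip: one_st_def)
qed

lemma prod_single_graph:
  "(\<Prod>i\<in>S. single (0, {#(i, p i)#}) 1) = (single (0, graph_mset S p) 1 :: 'g::comm_monoid_add \<times> _ \<Rightarrow>\<^sub>0 int)"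
  unfolding graph_mset_def
  by (induction S rule: infinite_finite_induct) (auto simp: mult_single zero_prod_def simp flip: single_one)

text \<open>The point is equality rather than surpassing: \<open>w\<close> contains no
  indeterminates, so the terms for different pairs \<open>(S, p)\<close> have disjoint keys and
  nothing cancels.\<close>

lemma absval_unit_leading_mult_minor_sum:
  assumes w: "unit_leading d w" and k: "k \<le> n"
  shows "absval (weight (\<lambda>(i, j). B i j)) (w * minor_sum n (\<lambda>i j. single (0, {#(i, j)#}) 1) (n - k))
    = Tang d * charpoly n B k"
proof -
  let ?b = "\<lambda>(i, j). B i j"
  let ?X = "SIGMA S:{S. S \<subseteq> {..<n} \<and> card S = n - k}. {p. p permutes S}"
  let ?f = "\<lambda>(S, p). single (0, graph_mset S p) (sign p) * w"
  have finS: "finite {S. S \<subseteq> {..<n} \<and> card S = n - k}"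
    by simp
  have finP: "finite {p. p permutes S}" if "S \<subseteq> {..<n}" for S
    using that finite_permutations finite_subset by blast
  have single_sign: "of_int (sign p) * single x 1 = (single x (sign p) :: _ \<Rightarrow>\<^sub>0 int)" for p :: "nat \<Rightarrow> nat" and x
    by (simp add: sign_def single_uminus)
  have "w * minor_sum n (\<lambda>i j. single (0, {#(i, j)#}) 1) (n - k) = sum ?f ?X"
    unfolding minor_sum_def minor_def prod_single_graph single_sign sum_distrib_left
    using finS finP by (subst sum.Sigma) (auto simp: mult.commute)
  also have "absval (weight ?b) \<dots> = (\<Sum>x\<in>?X. absval (weight ?b) (?f x))"
  proof (rule absval_sum_disjoint)
    show "finite ?X"
      using finS finP by (intro finite_SigmaI) auto
  next
    fix x y assume xy: "x \<in> ?X" "y \<in> ?X" "x \<noteq> y"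
    obtain S p T q where eq: "x = (S, p)" "y = (T, q)"
      by fastforce
    have fin: "finite S" "finite T"
      using xy eq finite_subset by auto
    have snd_key: "snd l = graph_mset S p" if l: "l \<in> keys (?f (S, p))" for l S p
    proof -
      from l obtain x y where "x \<in> keys (single (0, graph_mset S p) (sign p))" "y \<in> keys w" "l = x + y"
        using keys_mult[of "single (0, graph_mset S p) (sign p)" w] by auto
      then show ?thesis
        using unit_leading_keys[OF w] by (auto split: if_splits)
    qed
    have "graph_mset S p \<noteq> graph_mset T q"
      using graph_mset_inj[OF fin] xy eq by auto
    moreover have "graph_mset S p = graph_mset T q" if "l \<in> keys (?f x)" "l \<in> keys (?f y)" for l
      using snd_key[of l S p] snd_key[of l T q] that unfolding eq by simp
    ultimately show "keys (?f x) \<inter> keys (?f y) = {}"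
      by blast
  qed
  also have "\<dots> = (\<Sum>(S, p)\<in>?X. Tang d * (\<Prod>i\<in>S. B i (p i)))"
  proof (intro sum.cong refl)
    fix x assume "x \<in> ?X"
    obtain S p where x: "x = (S, p)"
      by fastforce
    have "absval (weight ?b) (single (0, graph_mset S p) (sign p) * w)
        = weight ?b (0, graph_mset S p) * absval (weight ?b) w"
      by (rule absval_mult_single) (auto simp: weight_add sign_def)
    then show "absval (weight ?b) (?f x) = (case x of (S, p) \<Rightarrow> Tang d * (\<Prod>i\<in>S. B i (p i)))"
      by (simp add: x absval_unit_leading[OF w] weight_graph_mset mult.commute)
  qed
  also have "\<dots> = Tang d * charpoly n B k"
    unfolding charpoly_def det_on_def using k finS finP
    by (subst sum.Sigma[symmetric]) (auto simp: sum_distrib_left)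
  finally show ?thesis .
qed

section \<open>Comparison of coefficients for tropically similar matrices\<close>

theorem theorem5p4:
  fixes n :: nat and A B B' :: "'g::linordered_ab_group_add smat"
  assumes "nonsingular n A"
    and "\<forall>i<n. \<forall>j<n. B' i j = smult n (smult n (nabla n A) B) A i j"
  shows "gs_poly (charpoly n B') (charpoly n B)"
  unfolding gs_poly_def
proof
  fix k
  show "gs (charpoly n B' k) (charpoly n B k)"
  proof (cases "k \<le> n")
    case False
    then show ?thesis by (simp add: charpoly_def)
  next
    case k: True
    obtain d where d: "sdet n A = Tang d"
      using assms(1) unfolding nonsingular_def by blast
    define b where "b = (\<lambda>(i, j). B i j)"
    define A' where "A' = (\<lambda>i j. tang_part (A i j) :: 'g \<times> (nat \<times> nat) multiset \<Rightarrow>\<^sub>0 int)"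
    define X where "X = (\<lambda>i j. single (0, {#(i, j)#}) 1 :: 'g \<times> (nat \<times> nat) multiset \<Rightarrow>\<^sub>0 int)"
    define t where "t = (single (- d, {#}) 1 :: 'g \<times> (nat \<times> nat) multiset \<Rightarrow>\<^sub>0 int)"
    \<comment> \<open>This copies the product defining \<open>B'\<close>, with \<open>t\<close> in
      place of the inverse of the determinant and the generic \<open>X\<close> in place of
      \<open>B\<close>.\<close>
    define C where "C = (\<lambda>i j. \<Sum>x<n. (\<Sum>l<n. t * adjugate n A' i l * X l x) * A' x j)"
    \<comment> \<open>In general \<open>u\<close> is not 1, as lower terms of the determinant may
      survive; it only has a unit leading term of value 0, so its powers must be carried
      along.\<close>
    define u where "u = t * minor {..<n} A'"
    define w where "w = minor {..<n} A' * u ^ (n - k)"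
    have A': "represents b (A i j) (A' i j)" for i j
      unfolding A'_def by (rule represents_tang_part)
    have X: "represents b (B i j) (X i j)" for i j
      using represents_single[of b "(0, {#(i, j)#})"]
      unfolding X_def by (simp add: weight_def b_def flip: one_st_def)
    have t: "represents b (st_inv (sdet n A)) t"
      using represents_single[of b "(- d, {#})"]
      unfolding t_def by (simp add: weight_def st_inv_def d)
    have "represents b (smult n (smult n (nabla n A) B) A i j) (C i j)" for i j
      unfolding smult_def nabla_def C_def
      by (intro represents_sum represents_mult represents_sadj A' X t)
    then have C: "represents b (charpoly n B' k) (minor_sum n C (n - k))"
      by (intro represents_charpoly k) (use assms(2) in auto)
    \<comment> \<open>Reordering the sums brings \<open>A'\<close> next to its adjugate, and
      \<open>mult_adjugate\<close> collapses their product to the determinant.\<close>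
    have "(\<Sum>y<n. A' i y * C y j) = (\<Sum>x<n. (u * X i x) * A' x j)" if i: "i < n" for i j
    proof -
      have "(\<Sum>y<n. A' i y * C y j)
          = (\<Sum>y<n. \<Sum>x<n. \<Sum>l<n. t * (A' i y * adjugate n A' y l) * X l x * A' x j)"
        unfolding C_def by (simp add: sum_distrib_left sum_distrib_right mult_ac)
      also have "\<dots> = (\<Sum>x<n. \<Sum>l<n. \<Sum>y<n. t * (A' i y * adjugate n A' y l) * X l x * A' x j)"
        by (subst sum.swap, rule sum.cong[OF refl], rule sum.swap)
      also have "\<dots> = (\<Sum>x<n. \<Sum>l<n. t * (\<Sum>y<n. A' i y * adjugate n A' y l) * X l x * A' x j)"
        by (simp add: sum_distrib_left sum_distrib_right)
      also have "\<dots> = (\<Sum>x<n. (u * X i x) * A' x j)"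
        using i by (simp add: mult_adjugate u_def if_distrib if_distribR cong: if_cong)
      finally show ?thesis .
    qed
    then have "minor {..<n} A' * minor_sum n C (n - k)
        = minor {..<n} A' * minor_sum n (\<lambda>i j. u * X i j) (n - k)"
      by (intro minor_sum_intertwine) auto
    \<comment> \<open>The determinant of \<open>A'\<close> times the minor sum of \<open>C\<close>
      represents the left-hand element; the ring identity then replaces \<open>C\<close> by
      \<open>u * X\<close>.\<close>
    then have "represents b (Tang d * charpoly n B' k) (w * minor_sum n X (n - k))"
      using represents_mult[OF represents_det_on[of "{..<n}" b A A'] C] A'
      by (simp add: minor_sum_scale w_def mult.assoc flip: d sdet_def)
    moreover have "unit_leading d w"
    proof -
      have "unit_leading d (minor {..<n} A')"
        unfolding A'_def by (rule unit_leading_minor[OF d])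
      moreover from this have "unit_leading 0 u"
        unfolding u_def t_def using unit_leading_mult[OF unit_leading_single[of "- d"]] by fastforce
      ultimately show ?thesis
        unfolding w_def using unit_leading_mult unit_leading_power by fastforce
    qed
    ultimately have "gs (Tang d * charpoly n B' k) (Tang d * charpoly n B k)"
      using absval_unit_leading_mult_minor_sum[OF _ k, of d w B]
      unfolding represents_def b_def X_def by simp
    \<comment> \<open>The common factor is tangible, hence invertible, and can be cancelled.\<close>
    then have "gs (Tang (- d) * (Tang d * charpoly n B' k)) (Tang (- d) * (Tang d * charpoly n B k))"
      by (rule gs_mult[OF gs_refl])
    moreover have "Tang (- d) * Tang d = 1"
      by (simp add: times_st_def one_st_def)
    ultimately show ?thesis
      by (simp flip: mult.assoc)
  qed
qed

end
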